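(* Let $\mathcal{M}$ be a von Neumann algebra with predual $\mathcal{M}_*$, let $\mathcal{A}$ be a weak* dense C*-subalgebra of $\mathcal{M}$, and let $x \in \mathcal{A}$. Then the following are equivalent: (i) $x$ is invertible in $\mathcal{A}$; (ii) $x$ is invertible in $\mathcal{M}$; (iii) there exist a unitary $u \in \mathcal{M}$ and an $\epsilon > 0$ such that $f(x) \geq \epsilon$ for all $f \in S^u$, where $S^u = \{f \in \mathcal{M}_* : f(u) = \|f\| = 1\}$.
   Context: $\mathcal{M}_*$ denotes the predual of $\mathcal{M}$, identified with the Banach space of weak*-continuous (normal) complex-linear functionals on $\mathcal{M}$; the weak* topology on $\mathcal{M}$ is the one induced by $\mathcal{M}_*$. A C*-subalgebra is a norm-closed $*$-subalgebra and is not assumed to be unital; that $x$ is invertible in $\mathcal{A}$ means that $\mathcal{A}$ has a unit and $x$ has a two-sided inverse in $\mathcal{A}$. The condition $f(x) \geq \epsilon$ means that the complex number $f(x)$ is real and at least $\epsilon$. *)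

theory Defs
  imports "HOL-Analysis.Analysis"
begin

section \<open>Complex Hilbert spaces\<close>

class scaleC = scaleR +
  fixes scaleC :: "complex \<Rightarrow> 'a \<Rightarrow> 'a"  (infixr \<open>*\<^sub>C\<close> 75)
  assumes scaleR_scaleC: "r *\<^sub>R x = complex_of_real r *\<^sub>C x"

class complex_vector = scaleC + ab_group_add +
  assumes scaleC_add_right: "a *\<^sub>C (x + y) = a *\<^sub>C x + a *\<^sub>C y"
    and scaleC_add_left: "(a + b) *\<^sub>C x = a *\<^sub>C x + b *\<^sub>C x"
    and scaleC_scaleC: "a *\<^sub>C b *\<^sub>C x = (a * b) *\<^sub>C x"
    and scaleC_one: "1 *\<^sub>C x = x"

text \<open>The inner product is linear in the first argument. The norm is the one of the
  underlying real inner product space, hence \<open>norm x = sqrt (Re (cinner x x))\<close>.\<close>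

class complex_inner = complex_vector + real_inner +
  fixes cinner :: "'a \<Rightarrow> 'a \<Rightarrow> complex"
  assumes cinner_commute: "cinner x y = cnj (cinner y x)"
    and cinner_add_left: "cinner (x + y) z = cinner x z + cinner y z"
    and cinner_scaleC_left: "cinner (c *\<^sub>C x) y = c * cinner x y"
    and inner_eq_Re_cinner: "inner x y = Re (cinner x y)"

class chilbert_space = complex_inner + complete_space

instantiation complex :: chilbert_space
begin

definition scaleC_complex :: "complex \<Rightarrow> complex \<Rightarrow> complex"
  where "scaleC_complex = (*)"

definition cinner_complex :: "complex \<Rightarrow> complex \<Rightarrow> complex"
  where "cinner_complex x y = x * cnj y"

instance
  by standard
    (simp_all add: scaleC_complex_def cinner_complex_def scaleR_conv_of_real algebra_simps
      inner_complex_def)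

end

lemma cinner_self_norm: "cinner x x = complex_of_real ((norm x)\<^sup>2)"
proof (rule complex_eqI)
  show "Re (cinner x x) = Re (complex_of_real ((norm x)\<^sup>2))"
    by (simp add: power2_norm_eq_inner inner_eq_Re_cinner)
  have "Im (cinner x x) = - Im (cinner x x)"
    by (subst cinner_commute) simp
  then show "Im (cinner x x) = Im (complex_of_real ((norm x)\<^sup>2))" by simp
qed

lemma cinner_scaleC_right: "cinner x (c *\<^sub>C y) = cnj c * cinner x y"
  by (metis cinner_commute cinner_scaleC_left complex_cnj_mult)

lemma norm_scaleC: "norm (c *\<^sub>C x) = cmod c * norm (x :: 'a :: complex_inner)"
proof -
  have "complex_of_real ((norm (c *\<^sub>C x))\<^sup>2) = (c * cnj c) * cinner x x"
    unfolding cinner_self_norm[symmetric]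
    by (simp add: cinner_scaleC_left cinner_scaleC_right)
  also have "\<dots> = complex_of_real ((cmod c * norm x)\<^sup>2)"
    by (simp add: cinner_self_norm power_mult_distrib flip: complex_norm_square)
  finally have "(norm (c *\<^sub>C x))\<^sup>2 = (cmod c * norm x)\<^sup>2"
    by (simp only: of_real_eq_iff)
  then show ?thesis by simp
qed

lemma bounded_linear_scaleC: "bounded_linear (\<lambda>x :: 'a :: complex_inner. c *\<^sub>C x)"
  by (rule bounded_linear_intro[where K = "cmod c"])
    (simp_all add: scaleC_add_right scaleR_scaleC scaleC_scaleC norm_scaleC mult.commute)


section \<open>Bounded operators\<close>

instantiation blinfun :: (real_normed_vector, complex_inner) complex_vector
begin

lift_definition scaleC_blinfun :: "complex \<Rightarrow> ('a \<Rightarrow>\<^sub>L 'b) \<Rightarrow> ('a \<Rightarrow>\<^sub>L 'b)"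
  is "\<lambda>c T x. c *\<^sub>C T x"
  by (rule bounded_linear_compose[OF bounded_linear_scaleC])

instance
  by standard
    (transfer, simp add: fun_eq_iff scaleR_scaleC scaleC_add_right scaleC_add_left
      scaleC_scaleC scaleC_one)+

end

text \<open>The type \<open>'h \<Rightarrow>\<^sub>L 'h\<close> consists of the bounded real-linear operators, with the operator
  norm; \<open>bounded_ops\<close> is the algebra \<open>B(H)\<close> of the complex-linear ones.\<close>

definition bounded_ops :: "('h :: chilbert_space \<Rightarrow>\<^sub>L 'h) set"
  where "bounded_ops = {T :: 'h \<Rightarrow>\<^sub>L 'h. \<forall>c v. T (c *\<^sub>C v) = c *\<^sub>C T v}"

definition adj_op :: "('h :: chilbert_space \<Rightarrow>\<^sub>L 'h) \<Rightarrow> ('h \<Rightarrow>\<^sub>L 'h)"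
  where "adj_op T = (THE S :: 'h \<Rightarrow>\<^sub>L 'h. \<forall>v w. cinner (T v) w = cinner v (S w))"

lemma riesz_real:
  fixes f :: "'a :: {real_inner, complete_space} \<Rightarrow> real"
  assumes "bounded_linear f"
  shows "\<exists>w. \<forall>v. f v = inner v w"
proof -
  interpret f: bounded_linear f by fact
  define \<phi> where "\<phi> v = (norm v)\<^sup>2 - 2 * f v" for v
  obtain K where K: "\<And>v. norm (f v) \<le> norm v * K" using f.bounded by blast
  have lower: "- (K\<^sup>2) \<le> \<phi> v" for v
  proof -
    have "f v \<le> norm v * K" using K[of v] by simp
    moreover have "0 \<le> (norm v - K)\<^sup>2" by simp
    ultimately show ?thesis unfolding \<phi>_def by (simp add: power2_diff)
  qed
  define m where "m = Inf (range \<phi>)"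
  have bdd: "bdd_below (range \<phi>)" using lower by (auto intro!: bdd_belowI)
  have m_le: "m \<le> \<phi> v" for v unfolding m_def by (rule cInf_lower[OF _ bdd]) simp
  define h where "h n = 1 / real (Suc n)" for n
  have h_pos: "h n > 0" for n by (simp add: h_def)
  have "\<exists>v. \<phi> v < m + h n" for n
    using cInf_lessD[of "range \<phi>" "m + h n"] h_pos[of n] unfolding m_def[symmetric] by auto
  then obtain X where X: "\<And>n. \<phi> (X n) < m + h n" by metis
  have para: "(norm (x - y))\<^sup>2 \<le> 2 * (\<phi> x - m) + 2 * (\<phi> y - m)" for x y
  proof -
    have "(norm (x - y))\<^sup>2 = 2 * \<phi> x + 2 * \<phi> y - 4 * \<phi> ((1/2) *\<^sub>R (x + y))"
      unfolding \<phi>_def power2_norm_eq_inner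
      by (simp add: f.scaleR f.add inner_add_left inner_add_right inner_diff_left
          inner_diff_right inner_commute algebra_simps)
    with m_le[of "(1/2) *\<^sub>R (x + y)"] show ?thesis by simp
  qed
  have "Cauchy X"
  proof (rule metric_CauchyI)
    fix e :: real assume "0 < e"
    then obtain N where N: "h N < e\<^sup>2 / 4"
      using nat_approx_posE[of "e\<^sup>2 / 4"] by (auto simp: h_def)
    have "dist (X p) (X q) < e" if "p \<ge> N" "q \<ge> N" for p q
    proof -
      have "h p \<le> h N" "h q \<le> h N"
        using that by (simp_all add: h_def frac_le)
      have "(norm (X p - X q))\<^sup>2 \<le> 2 * (\<phi> (X p) - m) + 2 * (\<phi> (X q) - m)"
        by (rule para)
      also have "\<dots> < 2 * h p + 2 * h q" using X[of p] X[of q] by simp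
      also have "\<dots> \<le> 4 * h N" using \<open>h p \<le> h N\<close> \<open>h q \<le> h N\<close> by simp
      also have "\<dots> < e\<^sup>2" using N by simp
      finally have "(norm (X p - X q))\<^sup>2 < e\<^sup>2" .
      then show ?thesis
        using \<open>0 < e\<close> by (simp add: dist_norm power_less_imp_less_base)
    qed
    then show "\<exists>M. \<forall>p\<ge>M. \<forall>q\<ge>M. dist (X p) (X q) < e" by blast
  qed
  then obtain w where w: "X \<longlonglongrightarrow> w" using Cauchy_convergent convergent_def by blast
  have "(\<lambda>n. \<phi> (X n)) \<longlonglongrightarrow> \<phi> w"
    unfolding \<phi>_def by (intro tendsto_intros w f.tendsto)
  moreover have "(\<lambda>n. m + h n) \<longlonglongrightarrow> m + 0"
    unfolding h_def by (intro tendsto_add tendsto_const) (use LIMSEQ_inverse_real_of_nat in \<open>simp add: inverse_eq_divide\<close>)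
  ultimately have "\<phi> w \<le> m"
    using X by (intro LIMSEQ_le[of "\<lambda>n. \<phi> (X n)" _ "\<lambda>n. m + h n"]) (auto intro: less_imp_le)
  then have min: "\<phi> w \<le> \<phi> v" for v using m_le[of v] by linarith
  have "f v = inner v w" for v
  proof -
    define a where "a = inner v w - f v"
    define s where "s = 1 / (1 + (norm v)\<^sup>2)"
    have s: "s > 0" "s * (norm v)\<^sup>2 < 1"
      unfolding s_def by (simp_all add: add_pos_nonneg field_simps)
    have "\<phi> w \<le> \<phi> (w + (- (s * a)) *\<^sub>R v)" by (rule min)
    then have "0 \<le> - 2 * s * a\<^sup>2 + s\<^sup>2 * a\<^sup>2 * (norm v)\<^sup>2"
      unfolding \<phi>_def a_def power2_norm_eq_inner
      by (simp add: f.scaleR f.add f.diff f.neg inner_add_left inner_add_right inner_diff_left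
          inner_diff_right inner_commute power2_eq_square algebra_simps)
    also have "\<dots> = s * a\<^sup>2 * (s * (norm v)\<^sup>2 - 2)"
      by (simp add: power2_eq_square algebra_simps)
    finally have "0 \<le> s * a\<^sup>2 * (s * (norm v)\<^sup>2 - 2)" .
    then have "a = 0"
      using s by (auto simp: zero_le_mult_iff mult_le_0_iff)
    then show ?thesis by (simp add: a_def)
  qed
  then show ?thesis by blast
qed

lemma adj_op_works:
  fixes T :: "'a :: chilbert_space \<Rightarrow>\<^sub>L 'a"
  assumes "T \<in> bounded_ops"
  shows "cinner (T v) w = cinner v (adj_op T w)"
proof -
  have "\<exists>z. \<forall>v. inner (T v) w = inner v z" for w
    by (rule riesz_real) (intro bounded_linear_intros)
  then obtain S where S: "\<And>v w. inner (T v) w = inner v (S w)" by metis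
  have ext: "x = y" if "\<And>v. inner v x = inner v y" for x y :: 'a
    using that[of "x - y"] inner_eq_zero_iff[of "x - y"] by (simp add: inner_diff_right)
  have "bounded_linear S"
  proof (rule bounded_linear_intro[where K = "norm T"])
    show "S (x + y) = S x + S y" for x y
      by (rule ext) (simp add: inner_add_right flip: S)
    show "S (r *\<^sub>R x) = r *\<^sub>R S x" for r x
      by (rule ext) (simp flip: S)
    show "norm (S x) \<le> norm x * norm T" for x
    proof -
      have "norm (S x) * norm (S x) = inner (T (S x)) x"
        by (simp add: S flip: power2_norm_eq_inner power2_eq_square)
      also have "\<dots> \<le> norm (T (S x)) * norm x" by (rule norm_cauchy_schwarz)
      also have "\<dots> \<le> norm T * norm (S x) * norm x"
        by (intro mult_right_mono norm_blinfun) simp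
      finally show ?thesis by (cases "S x = 0") (auto simp: mult_ac)
    qed
  qed
  then have app: "blinfun_apply (Blinfun S) = S" by (rule bounded_linear_Blinfun_apply)
  have Im: "Im (cinner x y) = Re (cinner ((- \<i>) *\<^sub>C x) y)" for x y :: 'a
    by (simp add: cinner_scaleC_left)
  have ex: "\<forall>v w. cinner (T v) w = cinner v (Blinfun S w)"
  proof (intro allI complex_eqI)
    fix v w
    show "Re (cinner (T v) w) = Re (cinner v (Blinfun S w))"
      using S by (simp add: app flip: inner_eq_Re_cinner)
    have "(- \<i>) *\<^sub>C T v = T ((- \<i>) *\<^sub>C v)" using assms by (simp add: bounded_ops_def)
    then show "Im (cinner (T v) w) = Im (cinner v (Blinfun S w))"
      using S unfolding Im app by (simp flip: inner_eq_Re_cinner)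
  qed
  moreover have "R = Blinfun S" if "\<forall>v w. cinner (T v) w = cinner v (R w)" for R :: "'a \<Rightarrow>\<^sub>L 'a"
  proof (rule blinfun_eqI, rule ext)
    fix w v
    show "inner v (R w) = inner v (Blinfun S w)"
      using that ex by (metis inner_eq_Re_cinner)
  qed
  ultimately have "adj_op T = Blinfun S"
    unfolding adj_op_def by (intro the_equality) auto
  then show ?thesis using ex by simp
qed


section \<open>Operator algebras\<close>

definition commutant :: "('h :: chilbert_space \<Rightarrow>\<^sub>L 'h) set \<Rightarrow> ('h \<Rightarrow>\<^sub>L 'h) set"
  where "commutant M = {S \<in> bounded_ops. \<forall>T\<in>M. S o\<^sub>L T = T o\<^sub>L S}"

definition von_neumann_algebra :: "('h :: chilbert_space \<Rightarrow>\<^sub>L 'h) set \<Rightarrow> bool"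
  where "von_neumann_algebra M \<longleftrightarrow>
    M \<subseteq> bounded_ops \<and> (\<forall>T\<in>M. adj_op T \<in> M) \<and> commutant (commutant M) = M"

definition cstar_subalgebra ::
  "('h :: chilbert_space \<Rightarrow>\<^sub>L 'h) set \<Rightarrow> ('h \<Rightarrow>\<^sub>L 'h) set \<Rightarrow> bool"
  where "cstar_subalgebra A M \<longleftrightarrow>
    A \<subseteq> M \<and> 0 \<in> A \<and>
    (\<forall>S\<in>A. \<forall>T\<in>A. S + T \<in> A) \<and>
    (\<forall>c. \<forall>T\<in>A. c *\<^sub>C T \<in> A) \<and>
    (\<forall>S\<in>A. \<forall>T\<in>A. S o\<^sub>L T \<in> A) \<and>
    (\<forall>T\<in>A. adj_op T \<in> A) \<and>
    closed A"

text \<open>The unit \<open>e\<close> of \<open>A\<close> is not required to be the identity operator.\<close>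

definition invertible_in ::
  "('h :: chilbert_space \<Rightarrow>\<^sub>L 'h) set \<Rightarrow> ('h \<Rightarrow>\<^sub>L 'h) \<Rightarrow> bool"
  where "invertible_in A x \<longleftrightarrow> x \<in> A \<and>
    (\<exists>e\<in>A. (\<forall>a\<in>A. e o\<^sub>L a = a \<and> a o\<^sub>L e = a) \<and>
      (\<exists>y\<in>A. x o\<^sub>L y = e \<and> y o\<^sub>L x = e))"

definition unitary_op :: "('h :: chilbert_space \<Rightarrow>\<^sub>L 'h) \<Rightarrow> bool"
  where "unitary_op u \<longleftrightarrow> u \<in> bounded_ops \<and>
    adj_op u o\<^sub>L u = id_blinfun \<and> u o\<^sub>L adj_op u = id_blinfun"


section \<open>The predual and the weak* topology\<close>

text \<open>The \<open>\<sigma>\<close>-weak (ultraweak) topology is the initial topology for the functionals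
  \<open>T \<mapsto> \<Sum>n. \<langle>T \<xi>\<^sub>n, \<eta>\<^sub>n\<rangle>\<close> with \<open>\<Sum>n. \<parallel>\<xi>\<^sub>n\<parallel>\<^sup>2\<close> and \<open>\<Sum>n. \<parallel>\<eta>\<^sub>n\<parallel>\<^sup>2\<close> finite.\<close>

definition l2_seq :: "(nat \<Rightarrow> 'h :: chilbert_space) \<Rightarrow> bool"
  where "l2_seq \<xi> \<longleftrightarrow> summable (\<lambda>n. (norm (\<xi> n))\<^sup>2)"

definition vector_functional ::
  "(nat \<Rightarrow> 'h :: chilbert_space) \<Rightarrow> (nat \<Rightarrow> 'h) \<Rightarrow> ('h \<Rightarrow>\<^sub>L 'h) \<Rightarrow> complex"
  where "vector_functional \<xi> \<eta> T = (\<Sum>n. cinner (T (\<xi> n)) (\<eta> n))"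

definition sigma_weak_topology :: "('h :: chilbert_space \<Rightarrow>\<^sub>L 'h) topology"
  where "sigma_weak_topology = topology_generated_by
    {vector_functional \<xi> \<eta> -` U | \<xi> \<eta> U. l2_seq \<xi> \<and> l2_seq \<eta> \<and> open U}"

text \<open>The predual of \<open>M\<close>, as the \<open>\<sigma>\<close>-weakly continuous complex-linear functionals on \<open>M\<close>.
  A functional on \<open>M\<close> is represented by any function that agrees with it on \<open>M\<close>.\<close>

definition predual ::
  "('h :: chilbert_space \<Rightarrow>\<^sub>L 'h) set \<Rightarrow> (('h \<Rightarrow>\<^sub>L 'h) \<Rightarrow> complex) set"
  where "predual M = {f.
    (\<forall>S\<in>M. \<forall>T\<in>M. f (S + T) = f S + f T) \<and>
    (\<forall>c. \<forall>T\<in>M. f (c *\<^sub>C T) = c * f T) \<and>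
    continuous_map (subtopology sigma_weak_topology M) euclidean f}"

definition functional_norm ::
  "('h :: chilbert_space \<Rightarrow>\<^sub>L 'h) set \<Rightarrow> (('h \<Rightarrow>\<^sub>L 'h) \<Rightarrow> complex) \<Rightarrow> real"
  where "functional_norm M f = (SUP T\<in>{T \<in> M. norm T \<le> 1}. cmod (f T))"

definition weak_star_topology ::
  "('h :: chilbert_space \<Rightarrow>\<^sub>L 'h) set \<Rightarrow> ('h \<Rightarrow>\<^sub>L 'h) topology"
  where "weak_star_topology M = topology_generated_by
    {{T \<in> M. f T \<in> U} | f U. f \<in> predual M \<and> open U}"

definition weak_star_dense ::
  "('h :: chilbert_space \<Rightarrow>\<^sub>L 'h) set \<Rightarrow> ('h \<Rightarrow>\<^sub>L 'h) set \<Rightarrow> bool"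
  where "weak_star_dense A M \<longleftrightarrow> A \<subseteq> M \<and> weak_star_topology M closure_of A = M"

definition normal_face ::
  "('h :: chilbert_space \<Rightarrow>\<^sub>L 'h) set \<Rightarrow> ('h \<Rightarrow>\<^sub>L 'h) \<Rightarrow> (('h \<Rightarrow>\<^sub>L 'h) \<Rightarrow> complex) set"
  where "normal_face M u = {f \<in> predual M. f u = 1 \<and> functional_norm M f = 1}"

end

(*
  Everything rests on the fact that a coercive operator T (Re <Tv,v> >= eps |v|^2) satisfies
  |1 - tT| < 1 for some t > 0. Then 1 and the inverse of T are fixed points of contractions
  W |-> tT + (1 - tT) W and W |-> 1 + (1 - tT) W, so both lie in every norm-closed subalgebra
  containing T.
  (i) => (ii): by density the unit of A acts as the identity.
  (ii) => (i): x* x is coercive, so A contains 1 and (x* x)^-1 x*.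
  (ii) => (iii): write x = u p with u unitary and p positive and invertible; for f in the face
  of u, the functional f(u .) has norm 1 and value 1 at 1, which makes f(x) real and bounded below.
  (iii) => (ii): for unit vectors v the functional T |-> <Tv, uv> lies in the face of u, so u* x
  is coercive.
*)

theory Submission
  imports Defs
begin

instance chilbert_space \<subseteq> banach ..

section \<open>Complex inner products and the Cauchy-Schwarz inequality\<close>

lemma cinner_add_right: "cinner x (y + z) = cinner x y + cinner x (z :: 'a :: complex_inner)"
  by (metis cinner_commute cinner_add_left complex_cnj_add)

lemma cinner_zero_left [simp]: "cinner 0 (y :: 'a :: complex_inner) = 0"
  using cinner_add_left[of 0 0 y] by simp

lemma scaleC_zero [simp]: "c *\<^sub>C (0 :: 'a :: complex_vector) = 0"
  using scaleC_add_right[of c 0 0] by simp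

lemma cinner_minus_left: "cinner (- x) y = - cinner x (y :: 'a :: complex_inner)"
  using cinner_add_left[of x "- x" y] by (simp add: eq_neg_iff_add_eq_0 add.commute)

lemma cinner_diff_left: "cinner (x - y) z = cinner x z - cinner y (z :: 'a :: complex_inner)"
  using cinner_add_left[of x "- y" z] by (simp add: cinner_minus_left)

lemma Im_cinner: "Im (cinner x y) = - inner (\<i> *\<^sub>C x) (y :: 'a :: complex_inner)"
  by (simp add: inner_eq_Re_cinner cinner_scaleC_left)

lemma cinner_extensional:
  assumes "\<And>v. cinner v x = cinner v (y :: 'a :: complex_inner)"
  shows "x = y"
proof -
  have "inner (x - y) x = inner (x - y) y" using assms by (simp add: inner_eq_Re_cinner)
  then have "inner (x - y) (x - y) = 0" by (simp only: inner_diff_right diff_self)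
  then show ?thesis by simp
qed

text \<open>A unimodular factor on \<open>x\<close> turns the inner product into its modulus, so the
  real Cauchy-Schwarz inequality applies.\<close>

lemma norm_cinner_le: "cmod (cinner x y) \<le> norm x * norm (y :: 'a :: complex_inner)"
proof (cases "cinner x y = 0")
  case False
  define c where "c = cnj (cinner x y) / cmod (cinner x y)"
  have c: "cmod c = 1" using False by (simp add: c_def norm_divide)
  have "c * cinner x y = complex_of_real (cmod (cinner x y))"
    using False
    by (simp add: c_def field_simps power2_eq_square flip: complex_norm_square)
  then have "cmod (cinner x y) = inner (c *\<^sub>C x) y"
    by (simp add: inner_eq_Re_cinner cinner_scaleC_left)
  also have "\<dots> \<le> norm (c *\<^sub>C x) * norm y" by (rule norm_cauchy_schwarz)
  finally show ?thesis by (simp add: norm_scaleC c)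
qed simp


section \<open>Operators and adjoints\<close>

lemmas blinfun_compose_add_right = bounded_bilinear.add_right[OF bounded_bilinear_blinfun_compose]
  and blinfun_compose_scaleR_left = bounded_bilinear.scaleR_left[OF bounded_bilinear_blinfun_compose]
  and blinfun_compose_scaleR_right = bounded_bilinear.scaleR_right[OF bounded_bilinear_blinfun_compose]

lemma blinfun_compose_id [simp]: "T o\<^sub>L id_blinfun = T" "id_blinfun o\<^sub>L T = T"
  by (rule blinfun_eqI, simp)+

lemma blinfun_compose_assoc: "(R o\<^sub>L S) o\<^sub>L T = R o\<^sub>L (S o\<^sub>L T)"
  by (rule blinfun_eqI) simp

lemma blinfun_eq_iff: "S = T \<longleftrightarrow> (\<forall>v. blinfun_apply S v = blinfun_apply T v)"
  by (auto intro: blinfun_eqI)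

lemma bounded_opsD: "T \<in> bounded_ops \<Longrightarrow> T (c *\<^sub>C v) = c *\<^sub>C T v"
  by (simp add: bounded_ops_def)

lemma cinner_adj_left:
  assumes "T \<in> bounded_ops"
  shows "cinner (adj_op T v) w = cinner v (T w)"
  by (metis adj_op_works[OF assms] cinner_commute)

text \<open>Self-adjointness phrased with the real inner product and without \<open>adj_op\<close>,
  so that it visibly passes to norm limits and real linear combinations. For complex-linear
  operators, \<open>symmetric_op_cinner\<close> recovers the complex form.\<close>

definition symmetric_op :: "('h :: chilbert_space \<Rightarrow>\<^sub>L 'h) \<Rightarrow> bool"
  where "symmetric_op T \<longleftrightarrow> (\<forall>v w. inner (T v) w = inner v (T w))"

text \<open>The imaginary part is a real inner product with \<open>\<i>\<close> applied to the first
  argument, and complex linearity moves \<open>\<i>\<close> through \<open>T\<close>.\<close>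

lemma symmetric_op_cinner:
  assumes "T \<in> bounded_ops" "symmetric_op T"
  shows "cinner (T v) w = cinner v (T w)"
proof (rule complex_eqI)
  show "Re (cinner (T v) w) = Re (cinner v (T w))"
    using assms(2) by (simp add: symmetric_op_def flip: inner_eq_Re_cinner)
  show "Im (cinner (T v) w) = Im (cinner v (T w))"
    using assms by (simp add: symmetric_op_def Im_cinner flip: bounded_opsD)
qed

lemma unitary_op_cinner:
  assumes "unitary_op u"
  shows "cinner (u v) (u w) = cinner v w"
  using assms adj_op_works[of u v "u w"]
  by (metis unitary_op_def blinfun_apply_blinfun_compose id_blinfun.rep_eq)

lemma unitary_op_norm:
  assumes "unitary_op u"
  shows "norm (u v) = norm v"
proof -
  have "(norm (u v))\<^sup>2 = (norm v)\<^sup>2"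
    using unitary_op_cinner[OF assms, of v v] by (simp only: cinner_self_norm of_real_eq_iff)
  then show ?thesis by simp
qed

text \<open>Expanding the square of |v - tTv| gives a linear gain of at least 2t\<epsilon> against a
  quadratic loss of at most t^2 |T|^2; a small \<open>t\<close> lets the gain win.\<close>

lemma coercive_contraction:
  fixes T :: "'a :: real_inner \<Rightarrow>\<^sub>L 'a"
  assumes "\<epsilon> > 0" "\<And>v. \<epsilon> * (norm v)\<^sup>2 \<le> inner (T v) v"
  obtains t where "t > 0" "norm (id_blinfun - t *\<^sub>R T) < 1"
proof
  \<comment> \<open>Chosen so that t |T|^2 \<le> \<epsilon>, which makes the quadratic term at most
    half of the gain; the summand 1 keeps the denominator positive.\<close>
  define t where "t = \<epsilon> / (1 + (norm T)\<^sup>2)"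
  have pos: "1 + (norm T)\<^sup>2 > 0" by (simp add: add_pos_nonneg)
  show t: "t > 0" using assms(1) pos by (simp add: t_def)
  have "t * (norm T)\<^sup>2 \<le> \<epsilon>"
    using assms(1) pos by (simp add: t_def field_simps)
  then have tT: "t * t * (norm T)\<^sup>2 \<le> t * \<epsilon>"
    using mult_left_mono[of _ _ t] t by (simp add: mult.assoc)
  \<comment> \<open>The cut-off at 0 matters only in the zero space, where \<open>\<epsilon>\<close>
    can be arbitrarily large.\<close>
  define r where "r = max 0 (1 - t * \<epsilon>)"
  have "norm ((id_blinfun - t *\<^sub>R T) v) \<le> sqrt r * norm v" for v
  proof -
    have "(norm (T v))\<^sup>2 \<le> (norm T * norm v)\<^sup>2"
      by (intro power_mono norm_blinfun) simp
    then have "t * t * (norm (T v))\<^sup>2 \<le> t * t * ((norm T)\<^sup>2 * (norm v)\<^sup>2)"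
      using t by (intro mult_left_mono) (simp_all add: power_mult_distrib)
    also have "\<dots> \<le> t * \<epsilon> * (norm v)\<^sup>2"
      using mult_right_mono[OF tT, of "(norm v)\<^sup>2"] by (simp add: mult_ac)
    finally have 1: "t * t * (norm (T v))\<^sup>2 \<le> t * \<epsilon> * (norm v)\<^sup>2" .
    have 2: "t * \<epsilon> * (norm v)\<^sup>2 \<le> t * inner (T v) v"
      using mult_left_mono[OF assms(2)[of v], of t] t by (simp add: mult_ac)
    have "(norm (v - t *\<^sub>R T v))\<^sup>2 = (norm v)\<^sup>2 - 2 * (t * inner (T v) v) + t * t * (norm (T v))\<^sup>2"
      unfolding power2_norm_eq_inner
      by (simp add: inner_diff_left inner_diff_right inner_commute algebra_simps)
    also have "\<dots> \<le> (1 - t * \<epsilon>) * (norm v)\<^sup>2" using 1 2 by (simp add: algebra_simps)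
    also have "\<dots> \<le> r * (norm v)\<^sup>2" by (intro mult_right_mono) (simp_all add: r_def)
    finally have "norm (v - t *\<^sub>R T v) \<le> sqrt (r * (norm v)\<^sup>2)" by (rule real_le_rsqrt)
    then show ?thesis by (simp add: real_sqrt_mult blinfun.diff_left blinfun.scaleR_left)
  qed
  then have "norm (id_blinfun - t *\<^sub>R T) \<le> sqrt r"
    by (intro norm_blinfun_bound) (simp_all add: r_def)
  also have "\<dots> < 1" using t assms(1) by (simp add: r_def)
  finally show "norm (id_blinfun - t *\<^sub>R T) < 1" .
qed


section \<open>Norm-closed subalgebras\<close>

context
  fixes A M :: "('h :: chilbert_space \<Rightarrow>\<^sub>L 'h) set"
  assumes A: "cstar_subalgebra A M"
begin

lemma cstar_add: "S \<in> A \<Longrightarrow> T \<in> A \<Longrightarrow> S + T \<in> A"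
  and cstar_comp: "S \<in> A \<Longrightarrow> T \<in> A \<Longrightarrow> S o\<^sub>L T \<in> A"
  and cstar_scaleC: "T \<in> A \<Longrightarrow> c *\<^sub>C T \<in> A"
  and cstar_adj: "T \<in> A \<Longrightarrow> adj_op T \<in> A"
  and cstar_nonempty: "A \<noteq> {}"
  and cstar_complete: "complete A"
  using A by (auto simp: cstar_subalgebra_def complete_eq_closed)

lemma cstar_scaleR: "T \<in> A \<Longrightarrow> r *\<^sub>R T \<in> A"
  by (simp add: scaleR_scaleC cstar_scaleC)

lemma cstar_diff: "S \<in> A \<Longrightarrow> T \<in> A \<Longrightarrow> S - T \<in> A"
  using cstar_add[of S "(-1) *\<^sub>R T"] cstar_scaleR[of T "-1"] by simp

text \<open>Supplies the unit of an algebra that is not assumed to be unital: completeness puts the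
  fixed point of the contraction into \<open>A\<close>.\<close>

lemma cstar_id:
  assumes "T \<in> A" "norm (id_blinfun - T) < 1"
  shows "id_blinfun \<in> A"
proof -
  \<comment> \<open>This is T + (1 - T) W, expanded so that \<open>F\<close> visibly maps
    \<open>A\<close> into itself before 1 is known to lie in \<open>A\<close>.\<close>
  define F where "F W = T + (W - (T o\<^sub>L W))" for W
  have F: "F V - F W = (id_blinfun - T) o\<^sub>L (V - W)" for V W
    by (rule blinfun_eqI) (simp add: F_def blinfun.diff_left blinfun.add_left blinfun.diff_right)
  have "\<exists>!W\<in>A. F W = W"
  proof (rule Banach_fix[OF cstar_complete cstar_nonempty norm_ge_zero assms(2)])
    show "F ` A \<subseteq> A" using assms(1) by (auto simp: F_def cstar_add cstar_diff cstar_comp)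
    show "dist (F V) (F W) \<le> norm (id_blinfun - T) * dist V W" for V W
      unfolding dist_norm F by (rule norm_blinfun_compose)
  qed
  then obtain W where W: "W \<in> A" "F W = W" by blast
  \<comment> \<open>The identity is also a fixed point of the contraction, hence the one found in \<open>A\<close>.\<close>
  have "F id_blinfun = id_blinfun" by (rule blinfun_eqI) (simp add: F_def blinfun.diff_left blinfun.add_left)
  then have "norm (id_blinfun - W) \<le> norm (id_blinfun - T) * norm (id_blinfun - W)"
    using F[of id_blinfun W] norm_blinfun_compose[of "id_blinfun - T" "id_blinfun - W"] W by simp
  then have "id_blinfun = W"
    using assms(2) by (simp add: mult_le_cancel_right1)
  then show ?thesis using W by simp
qed

text \<open>The Neumann series in fixed-point form: W = 1 + (1 - T) W says that TW = 1, and the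
  mirrored equation gives a left inverse. The two one-sided inverses then coincide.\<close>

lemma cstar_inverse:
  assumes "T \<in> A" "norm (id_blinfun - T) < 1"
  obtains S where "S \<in> A" "T o\<^sub>L S = id_blinfun" "S o\<^sub>L T = id_blinfun"
proof -
  note id = cstar_id[OF assms]
  have "\<exists>!W\<in>A. id_blinfun + (W - (T o\<^sub>L W)) = W"
  proof (rule Banach_fix[OF cstar_complete cstar_nonempty norm_ge_zero assms(2)])
    show "(\<lambda>W. id_blinfun + (W - (T o\<^sub>L W))) ` A \<subseteq> A"
      using assms(1) id by (auto simp: cstar_add cstar_diff cstar_comp)
    fix V W
    have "(id_blinfun + (V - (T o\<^sub>L V))) - (id_blinfun + (W - (T o\<^sub>L W))) = (id_blinfun - T) o\<^sub>L (V - W)"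
      by (rule blinfun_eqI) (simp add: blinfun.diff_left blinfun.add_left blinfun.diff_right)
    then show "dist (id_blinfun + (V - (T o\<^sub>L V))) (id_blinfun + (W - (T o\<^sub>L W)))
        \<le> norm (id_blinfun - T) * dist V W"
      unfolding dist_norm by (metis norm_blinfun_compose)
  qed
  then obtain S where "S \<in> A" "id_blinfun + (S - (T o\<^sub>L S)) = S" by blast
  then have S: "S \<in> A" "T o\<^sub>L S = id_blinfun" by (simp_all add: algebra_simps)
  have "\<exists>!W\<in>A. id_blinfun + (W - (W o\<^sub>L T)) = W"
  proof (rule Banach_fix[OF cstar_complete cstar_nonempty norm_ge_zero assms(2)])
    show "(\<lambda>W. id_blinfun + (W - (W o\<^sub>L T))) ` A \<subseteq> A"
      using assms(1) id by (auto simp: cstar_add cstar_diff cstar_comp)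
    fix V W
    have "(id_blinfun + (V - (V o\<^sub>L T))) - (id_blinfun + (W - (W o\<^sub>L T))) = (V - W) o\<^sub>L (id_blinfun - T)"
      by (rule blinfun_eqI) (simp add: blinfun.diff_left blinfun.add_left blinfun.diff_right)
    then show "dist (id_blinfun + (V - (V o\<^sub>L T))) (id_blinfun + (W - (W o\<^sub>L T)))
        \<le> norm (id_blinfun - T) * dist V W"
      unfolding dist_norm by (metis norm_blinfun_compose mult.commute)
  qed
  then obtain R where "id_blinfun + (R - (R o\<^sub>L T)) = R" by blast
  then have R: "R o\<^sub>L T = id_blinfun" by (simp add: algebra_simps)
  have "R = (R o\<^sub>L T) o\<^sub>L S" by (simp add: blinfun_compose_assoc S)
  then have "R = S" by (simp add: R)
  with S R that show thesis by blast
qed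

text \<open>Only a multiple of \<open>T\<close> is close to 1; the scalar is absorbed into the
  inverse.\<close>

lemma cstar_coercive_inverse:
  assumes "T \<in> A" "\<epsilon> > 0" "\<And>v. \<epsilon> * (norm v)\<^sup>2 \<le> inner (T v) v"
  obtains S where "id_blinfun \<in> A" "S \<in> A" "T o\<^sub>L S = id_blinfun" "S o\<^sub>L T = id_blinfun"
proof -
  obtain t where t: "t > 0" "norm (id_blinfun - t *\<^sub>R T) < 1"
    using coercive_contraction[OF assms(2,3)] .
  note tT = cstar_scaleR[OF assms(1), of t]
  obtain S where S: "S \<in> A" "(t *\<^sub>R T) o\<^sub>L S = id_blinfun" "S o\<^sub>L (t *\<^sub>R T) = id_blinfun"
    using cstar_inverse[OF tT t(2)] .
  show thesis
  proof (rule that[of "t *\<^sub>R S"])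
    show "id_blinfun \<in> A" by (rule cstar_id[OF tT t(2)])
    show "t *\<^sub>R S \<in> A" using S by (intro cstar_scaleR)
    show "T o\<^sub>L t *\<^sub>R S = id_blinfun" "t *\<^sub>R S o\<^sub>L T = id_blinfun"
      using S(2,3) by (simp_all add: blinfun_compose_scaleR_left blinfun_compose_scaleR_right)
  qed
qed

text \<open>With \<open>B = 1 - T\<close>, the contraction \<open>W \<mapsto> (B + W\<^sup>2) / 2\<close> has a fixed point \<open>W\<close>, for which
  \<open>(1 - W)\<^sup>2 = 1 - B = T\<close>.\<close>

lemma cstar_sqrt:
  assumes "id_blinfun \<in> A" "A \<subseteq> bounded_ops" "T \<in> A" "symmetric_op T" "norm (id_blinfun - T) < 1"
  obtains S where "S \<in> A" "symmetric_op S" "norm (id_blinfun - S) < 1" "S o\<^sub>L S = T"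
proof -
  define B where "B = id_blinfun - T"
  define r where "r = norm B"
  \<comment> \<open>The radius r < 1 makes the map below a contraction with factor \<open>r\<close>;
    symmetry is put into the set so that the fixed point inherits it.\<close>
  define X where "X = {W \<in> A. symmetric_op W \<and> norm W \<le> r}"
  define F where "F W = (1/2) *\<^sub>R (B + (W o\<^sub>L W))" for W
  have r: "0 \<le> r" "r < 1" using assms(5) by (simp_all add: r_def B_def)
  have "closed {W :: 'h \<Rightarrow>\<^sub>L 'h. symmetric_op W \<and> norm W \<le> r}"
    unfolding symmetric_op_def
    by (intro closed_Collect_conj closed_Collect_all closed_Collect_eq closed_Collect_le continuous_intros)
  then have "complete X"
    unfolding X_def using cstar_complete
    by (simp add: Collect_conj_eq complete_eq_closed closed_Int)
  moreover have "0 \<in> X"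
    using r A by (simp add: X_def symmetric_op_def cstar_subalgebra_def)
  then have "X \<noteq> {}" by blast
  moreover have "F ` X \<subseteq> X"
  proof safe
    fix W assume W: "W \<in> X"
    have "B \<in> A" using assms(1,3) by (simp add: B_def cstar_diff)
    then have "F W \<in> A" using W by (simp add: F_def X_def cstar_scaleR cstar_add cstar_comp)
    moreover have "symmetric_op (F W)"
      using W assms(4)
      by (simp add: X_def F_def B_def symmetric_op_def blinfun.diff_left blinfun.add_left
          blinfun.scaleR_left inner_add_left inner_add_right inner_diff_left inner_diff_right)
    moreover have "norm (F W) \<le> r"
    proof -
      have "norm (W o\<^sub>L W) \<le> norm W * norm W" by (rule norm_blinfun_compose)
      also have "\<dots> \<le> r * 1" using W r by (intro mult_mono) (simp_all add: X_def)
      finally have "norm (B + (W o\<^sub>L W)) \<le> r + r"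
        by (intro norm_triangle_le) (simp add: r_def)
      then show ?thesis by (simp add: F_def)
    qed
    ultimately show "F W \<in> X" by (simp add: X_def)
  qed
  moreover have "dist (F V) (F W) \<le> r * dist V W" if "V \<in> X" "W \<in> X" for V W
  proof -
    \<comment> \<open>The difference of squares is split as V(V - W) + (V - W)W, since
      \<open>V\<close> and \<open>W\<close> need not commute.\<close>
    have "F V - F W = (1/2) *\<^sub>R ((V o\<^sub>L (V - W)) + ((V - W) o\<^sub>L W))"
      by (rule blinfun_eqI)
        (simp add: F_def blinfun.diff_left blinfun.add_left blinfun.diff_right blinfun.scaleR_left
          flip: scaleR_diff_right)
    moreover have "norm (V o\<^sub>L (V - W)) \<le> r * norm (V - W)"
      using that by (intro order_trans[OF norm_blinfun_compose] mult_right_mono) (simp_all add: X_def)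
    moreover have "norm ((V - W) o\<^sub>L W) \<le> norm (V - W) * r"
      using that by (intro order_trans[OF norm_blinfun_compose] mult_left_mono) (simp_all add: X_def)
    ultimately show ?thesis
      unfolding dist_norm
      using norm_triangle_ineq[of "V o\<^sub>L (V - W)" "(V - W) o\<^sub>L W"] by (simp add: mult.commute)
  qed
  ultimately have "\<exists>!W\<in>X. F W = W"
    using r by (intro Banach_fix[of X r F]) auto
  then obtain W where W: "W \<in> X" "F W = W" by blast
  show thesis
  proof (rule that[of "id_blinfun - W"])
    show "id_blinfun - W \<in> A" using W assms(1) by (simp add: X_def cstar_diff)
    show "symmetric_op (id_blinfun - W)"
      using W by (simp add: X_def symmetric_op_def blinfun.diff_left inner_diff_left inner_diff_right)
    show "norm (id_blinfun - (id_blinfun - W)) < 1" using W r by (simp add: X_def)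
    have "B + (W o\<^sub>L W) = 2 *\<^sub>R F W" by (simp add: F_def)
    also have "\<dots> = W + W" using W by (simp add: scaleR_2)
    finally have "W o\<^sub>L W = W + W - B" by (simp add: algebra_simps)
    then have "W (W v) = W v + W v - B v" for v
      by (metis blinfun_apply_blinfun_compose blinfun.add_left blinfun.diff_left)
    then show "(id_blinfun - W) o\<^sub>L (id_blinfun - W) = T"
      by (intro blinfun_eqI) (simp add: B_def blinfun.diff_left blinfun.diff_right)
  qed
qed

end


section \<open>Von Neumann algebras and their preduals\<close>

text \<open>An intersection of equations between norm-continuous functions of \<open>S\<close>. It
  yields norm-closedness of a von Neumann algebra, which is itself a commutant.\<close>

lemma closed_commutant: "closed (commutant M)"
proof -
  have eq: "commutant M = {S. (\<forall>c v. blinfun_apply S (c *\<^sub>C v) = c *\<^sub>C S v) \<and> (\<forall>T\<in>M. S o\<^sub>L T = T o\<^sub>L S)}"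
    by (auto simp: commutant_def bounded_ops_def)
  show ?thesis
    unfolding eq Ball_def
    by (intro closed_Collect_conj closed_Collect_all closed_Collect_imp open_Collect_const closed_Collect_eq
        continuous_intros bounded_linear.continuous_on[OF bounded_linear_scaleC])
qed

context
  fixes M :: "('h :: chilbert_space \<Rightarrow>\<^sub>L 'h) set"
  assumes M: "von_neumann_algebra M"
begin

lemma vn_bounded_ops: "M \<subseteq> bounded_ops"
  using M by (simp add: von_neumann_algebra_def)

lemma vn_id: "id_blinfun \<in> M"
proof -
  have "id_blinfun \<in> commutant (commutant M)"
    by (auto simp: commutant_def bounded_ops_def intro: blinfun_eqI)
  then show ?thesis using M by (simp add: von_neumann_algebra_def)
qed

text \<open>Makes the results on norm-closed subalgebras available for \<open>M\<close>
  itself.\<close>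

lemma vn_cstar: "cstar_subalgebra M M"
proof -
  define C where "C = commutant M"
  have C: "commutant C = M" using M by (simp add: von_neumann_algebra_def C_def)
  have iff: "T \<in> M \<longleftrightarrow> (\<forall>c v. T (c *\<^sub>C v) = c *\<^sub>C T v) \<and> (\<forall>S\<in>C. \<forall>v. T (S v) = S (T v))"
    for T :: "'h \<Rightarrow>\<^sub>L 'h"
    unfolding C[symmetric] commutant_def bounded_ops_def blinfun_eq_iff by simp
  have lin: "S (c *\<^sub>C v) = c *\<^sub>C S v" if "S \<in> C" for S :: "'h \<Rightarrow>\<^sub>L 'h" and c v
    using that by (simp add: C_def commutant_def bounded_ops_def)
  have "closed M" unfolding C[symmetric] by (rule closed_commutant)
  moreover have "\<forall>T\<in>M. adj_op T \<in> M" using M by (simp add: von_neumann_algebra_def)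
  moreover have "0 \<in> M" by (simp add: iff)
  moreover have "S + T \<in> M" if "S \<in> M" "T \<in> M" for S T
    using that by (simp add: iff blinfun.add_left blinfun.add_right scaleC_add_right)
  moreover have "S o\<^sub>L T \<in> M" if "S \<in> M" "T \<in> M" for S T
    using that by (simp add: iff)
  moreover have "c *\<^sub>C T \<in> M" if "T \<in> M" for c T
    using that lin by (simp add: iff scaleC_blinfun.rep_eq scaleC_scaleC mult.commute)
  ultimately show ?thesis by (simp add: cstar_subalgebra_def)
qed

lemma invertible_in_vn_iff:
  "invertible_in M x \<longleftrightarrow> x \<in> M \<and> (\<exists>y\<in>M. x o\<^sub>L y = id_blinfun \<and> y o\<^sub>L x = id_blinfun)"
proof -
  have "(\<forall>a\<in>M. e o\<^sub>L a = a \<and> a o\<^sub>L e = a) \<longleftrightarrow> e = id_blinfun" for e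
    using vn_id by (metis blinfun_compose_id)
  then show ?thesis using vn_id by (simp add: invertible_in_def)
qed

end

section \<open>Vector functionals, the sigma-weak topology and norms on the predual\<close>

lemma l2_seq_single: "l2_seq (\<lambda>n. if n = 0 then v else 0)"
proof -
  have "(\<lambda>n. (norm (if n = (0::nat) then v else 0))\<^sup>2) = (\<lambda>n. if n = 0 then (norm v)\<^sup>2 else 0)"
    by auto
  then show ?thesis
    unfolding l2_seq_def using summable_single[of 0 "\<lambda>_. (norm v)\<^sup>2"] by simp
qed

lemma vector_functional_single:
  "vector_functional (\<lambda>n. if n = 0 then v else 0) (\<lambda>n. if n = 0 then w else 0) T = cinner (T v) w"
proof -
  have "(\<lambda>n. cinner (T (if n = (0::nat) then v else 0)) (if n = 0 then w else 0))
      = (\<lambda>n. if n = 0 then cinner (T v) w else 0)" by auto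
  then show ?thesis
    unfolding vector_functional_def
    using sums_unique[OF sums_single[of 0 "\<lambda>_. cinner (T v) w"]] by simp
qed

lemma openin_sigma_weak_vimage:
  assumes "l2_seq \<xi>" "l2_seq \<eta>" "open U"
  shows "openin sigma_weak_topology (vector_functional \<xi> \<eta> -` U)"
  unfolding sigma_weak_topology_def
  by (rule topology_generated_by_Basis) (use assms in blast)

lemma topspace_sigma_weak [simp]: "topspace sigma_weak_topology = UNIV"
  using openin_subset[OF openin_sigma_weak_vimage[OF l2_seq_single l2_seq_single open_UNIV]] by auto

lemma continuous_map_vector_functional:
  assumes "l2_seq \<xi>" "l2_seq \<eta>"
  shows "continuous_map sigma_weak_topology euclidean (vector_functional \<xi> \<eta>)"
  using openin_sigma_weak_vimage[OF assms] by (simp add: continuous_map_def vimage_def)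

text \<open>Sequences with a single non-zero entry exhibit these as normal functionals. They serve
  both to test density and to populate the faces.\<close>

lemma cinner_in_predual: "(\<lambda>T. cinner (blinfun_apply T v) w) \<in> predual M"
proof -
  have "vector_functional (\<lambda>n. if n = 0 then v else 0) (\<lambda>n. if n = 0 then w else 0)
      = (\<lambda>T. cinner (blinfun_apply T v) w)"
    by (rule ext) (rule vector_functional_single)
  then have "continuous_map sigma_weak_topology euclidean (\<lambda>T. cinner (blinfun_apply T v) w)"
    using continuous_map_vector_functional[OF l2_seq_single[of v] l2_seq_single[of w]] by simp
  then show ?thesis
    unfolding predual_def
    by (simp add: continuous_map_from_subtopology blinfun.add_left cinner_add_left
        scaleC_blinfun.rep_eq cinner_scaleC_left)
qed

text \<open>Since ab \<le> a^2 + b^2, the series is dominated termwise by |T| times a summable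
  sequence, so the functional is bounded in the operator norm.\<close>

lemma continuous_on_vector_functional:
  assumes "l2_seq \<xi>" "l2_seq \<eta>"
  shows "continuous_on UNIV (vector_functional \<xi> \<eta>)"
proof -
  have le: "norm (cinner (T (\<xi> n)) (\<eta> n)) \<le> norm T * ((norm (\<xi> n))\<^sup>2 + (norm (\<eta> n))\<^sup>2)"
    for T :: "'a \<Rightarrow>\<^sub>L 'a" and n
  proof -
    have "norm (cinner (T (\<xi> n)) (\<eta> n)) \<le> norm (T (\<xi> n)) * norm (\<eta> n)" by (rule norm_cinner_le)
    also have "\<dots> \<le> norm T * norm (\<xi> n) * norm (\<eta> n)" by (intro mult_right_mono norm_blinfun) simp
    also have "\<dots> \<le> norm T * ((norm (\<xi> n))\<^sup>2 + (norm (\<eta> n))\<^sup>2)"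
    proof -
      have "0 \<le> norm (\<xi> n) * norm (\<eta> n)" by simp
      then have "norm (\<xi> n) * norm (\<eta> n) \<le> (norm (\<xi> n))\<^sup>2 + (norm (\<eta> n))\<^sup>2"
        using sum_squares_bound[of "norm (\<xi> n)" "norm (\<eta> n)"] by linarith
      then show ?thesis by (simp add: mult.assoc mult_left_mono)
    qed
    finally show ?thesis .
  qed
  have sm: "summable (\<lambda>n. norm T * ((norm (\<xi> n))\<^sup>2 + (norm (\<eta> n))\<^sup>2))" for T :: "'a \<Rightarrow>\<^sub>L 'a"
    using assms by (intro summable_mult summable_add) (simp_all add: l2_seq_def)
  have sc: "summable (\<lambda>n. cinner (T (\<xi> n)) (\<eta> n))" for T :: "'a \<Rightarrow>\<^sub>L 'a"
    by (rule summable_comparison_test'[OF sm[of T] le])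
  have "bounded_linear (vector_functional \<xi> \<eta>)"
  proof (rule bounded_linear_intro)
    show "vector_functional \<xi> \<eta> (S + T) = vector_functional \<xi> \<eta> S + vector_functional \<xi> \<eta> T" for S T
      unfolding vector_functional_def
      by (simp add: blinfun.add_left cinner_add_left suminf_add[OF sc sc, symmetric])
    show "vector_functional \<xi> \<eta> (r *\<^sub>R T) = r *\<^sub>R vector_functional \<xi> \<eta> T" for r T
      unfolding vector_functional_def
      by (simp add: blinfun.scaleR_left scaleR_scaleC[of r "_ :: 'a"] cinner_scaleC_left
          suminf_mult[OF sc] scaleR_conv_of_real)
    show "norm (vector_functional \<xi> \<eta> T) \<le> norm T * (\<Sum>n. (norm (\<xi> n))\<^sup>2 + (norm (\<eta> n))\<^sup>2)" for T
    proof -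
      have "norm (vector_functional \<xi> \<eta> T) \<le> (\<Sum>n. norm T * ((norm (\<xi> n))\<^sup>2 + (norm (\<eta> n))\<^sup>2))"
        unfolding vector_functional_def by (rule norm_suminf_le[OF le sm])
      also have "\<dots> = norm T * (\<Sum>n. (norm (\<xi> n))\<^sup>2 + (norm (\<eta> n))\<^sup>2)"
        using assms by (intro suminf_mult summable_add) (simp_all add: l2_seq_def)
      finally show ?thesis .
    qed
  qed
  then show ?thesis by (rule linear_continuous_on)
qed

text \<open>The subbasic sets are norm-open by continuity of the vector functionals, and generation
  preserves this.\<close>

lemma openin_sigma_weak_imp_open:
  assumes "openin sigma_weak_topology U"
  shows "open U"
proof -
  have "generate_topology_on
      {vector_functional \<xi> \<eta> -` V | \<xi> \<eta> V. l2_seq \<xi> \<and> l2_seq \<eta> \<and> open V} U"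
    using assms by (simp add: sigma_weak_topology_def openin_topology_generated_by_iff)
  then show ?thesis
  proof induction
    case (Basis s)
    then show ?case
      using open_vimage[OF _ continuous_on_vector_functional] by blast
  qed auto
qed

text \<open>Without boundedness the supremum in \<open>functional_norm\<close> would be a junk value.\<close>

lemma predual_bdd_above:
  assumes M: "cstar_subalgebra M M" and f: "f \<in> predual M"
  shows "bdd_above ((\<lambda>T. cmod (f T)) ` {T \<in> M. norm T \<le> 1})"
proof -
  have scale: "f (c *\<^sub>C T) = c * f T" if "T \<in> M" for c T using f that by (simp add: predual_def)
  have 0: "0 \<in> M" using M by (simp add: cstar_subalgebra_def)
  have f0: "f 0 = 0" using scale[OF 0, of 0] by simp
  \<comment> \<open>The preimage of the unit ball contains all elements of \<open>M\<close> in some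
    norm ball of radius \<open>d\<close>. Scaling by \<open>d/2\<close> moves the unit ball of
    \<open>M\<close> into it and gives the bound \<open>2 / d\<close>.\<close>
  have "openin (subtopology sigma_weak_topology M) {T \<in> topspace (subtopology sigma_weak_topology M). f T \<in> ball 0 1}"
    by (rule openin_continuous_map_preimage[where Y = euclidean]) (use f in \<open>auto simp: predual_def\<close>)
  then obtain U where U: "openin sigma_weak_topology U"
    "{T \<in> topspace (subtopology sigma_weak_topology M). f T \<in> ball 0 1} = U \<inter> M"
    unfolding openin_subtopology by auto
  have "0 \<in> U \<inter> M" unfolding U(2)[symmetric] using 0 f0 by simp
  then have "0 \<in> U" by simp
  then obtain d where d: "d > 0" "ball 0 d \<subseteq> U"
    using openin_sigma_weak_imp_open[OF U(1)] open_contains_ball by blast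
  have "cmod (f T) \<le> 2 / d" if T: "T \<in> M" "norm T \<le> 1" for T
  proof -
    have "norm ((d/2) *\<^sub>R T) < d" using T(2) d(1) by (simp add: mult_le_cancel_left1 field_simps)
    then have "(d/2) *\<^sub>R T \<in> U \<inter> M"
      using d(2) cstar_scaleR[OF M T(1)] by auto
    then have "cmod (f ((d/2) *\<^sub>R T)) < 1" unfolding U(2)[symmetric] by simp
    then have "d / 2 * cmod (f T) < 1"
      using d(1) T(1) by (simp add: scaleR_scaleC scale norm_mult)
    then show ?thesis using d(1) by (simp add: field_simps)
  qed
  then show ?thesis by (auto intro!: bdd_aboveI)
qed

lemma predual_norm_le:
  assumes M: "cstar_subalgebra M M" and f: "f \<in> predual M" and T: "T \<in> M"
  shows "cmod (f T) \<le> functional_norm M f * norm T"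
proof (cases "T = 0")
  case True
  have "f (0 *\<^sub>C T) = 0 * f T" using f T unfolding predual_def by blast
  then show ?thesis using True by simp
next
  case False
  have "cmod (f ((1 / norm T) *\<^sub>R T)) \<le> functional_norm M f"
    unfolding functional_norm_def
    by (rule cSUP_upper[OF _ predual_bdd_above[OF M f]]) (simp add: cstar_scaleR[OF M T] False)
  moreover have "f ((1 / norm T) *\<^sub>R T) = complex_of_real (1 / norm T) * f T"
    using f T unfolding predual_def scaleR_scaleC by blast
  ultimately show ?thesis using False by (simp add: norm_mult norm_divide field_simps)
qed

text \<open>The right-hand norm is at most the square root of \<open>\<parallel>T\<parallel>\<^sup>2 + k\<^sup>2\<close>, whereas an imaginary part of
  \<open>z\<close> would make the left-hand side grow faster as \<open>k\<close> tends to plus or minus infinity.\<close>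

lemma real_of_cmod_le_norm_symmetric_op:
  assumes "T \<in> bounded_ops" "symmetric_op T"
    and "\<And>k. cmod (z + \<i> * complex_of_real k) \<le> norm (T + (\<i> * complex_of_real k) *\<^sub>C id_blinfun)"
  shows "z \<in> \<real>"
proof -
  have bound: "2 * (k * Im z) \<le> (norm T)\<^sup>2" for k
  proof -
    let ?R = "T + (\<i> * complex_of_real k) *\<^sub>C id_blinfun"
    have "norm (?R v) \<le> sqrt ((norm T)\<^sup>2 + k\<^sup>2) * norm v" for v
    proof -
      let ?w = "(\<i> * complex_of_real k) *\<^sub>C v"
      \<comment> \<open>As <Tv, v> is real, \<open>T v\<close> and \<open>?w\<close> are orthogonal
        for the real inner product, and Pythagoras applies.\<close>
      have "cinner (T v) v = cnj (cinner (T v) v)"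
        using symmetric_op_cinner[OF assms(1,2), of v v] cinner_commute by metis
      then have "Im (cinner (T v) v) = 0"
        by (metis Reals_cnj_iff complex_is_Real_iff)
      then have "inner (T v) ?w = 0"
        by (simp add: inner_eq_Re_cinner cinner_scaleC_right)
      then have "(norm (?R v))\<^sup>2 = (norm (T v))\<^sup>2 + (norm ?w)\<^sup>2"
        unfolding power2_norm_eq_inner
        by (simp add: blinfun.add_left scaleC_blinfun.rep_eq inner_add_left inner_add_right inner_commute)
      also have "\<dots> = (norm (T v))\<^sup>2 + k\<^sup>2 * (norm v)\<^sup>2"
        by (simp add: norm_scaleC norm_mult power_mult_distrib)
      also have "\<dots> \<le> (norm T * norm v)\<^sup>2 + k\<^sup>2 * (norm v)\<^sup>2"
        by (intro add_right_mono power_mono norm_blinfun) simp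
      also have "\<dots> = ((norm T)\<^sup>2 + k\<^sup>2) * (norm v)\<^sup>2" by (simp add: power_mult_distrib algebra_simps)
      finally have "norm (?R v) \<le> sqrt (((norm T)\<^sup>2 + k\<^sup>2) * (norm v)\<^sup>2)" by (rule real_le_rsqrt)
      then show ?thesis by (simp add: real_sqrt_mult)
    qed
    then have "norm ?R \<le> sqrt ((norm T)\<^sup>2 + k\<^sup>2)" by (intro norm_blinfun_bound) simp_all
    with assms(3)[of k] have "cmod (z + \<i> * complex_of_real k) \<le> sqrt ((norm T)\<^sup>2 + k\<^sup>2)" by simp
    then have "(cmod (z + \<i> * complex_of_real k))\<^sup>2 \<le> (sqrt ((norm T)\<^sup>2 + k\<^sup>2))\<^sup>2"
      by (rule power_mono) simp
    then have "(Re z)\<^sup>2 + (Im z + k)\<^sup>2 \<le> (norm T)\<^sup>2 + k\<^sup>2" by (simp add: cmod_power2)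
    then have "(Re z)\<^sup>2 + (Im z)\<^sup>2 + 2 * (k * Im z) \<le> (norm T)\<^sup>2"
      by (simp add: power2_sum algebra_simps)
    then show ?thesis using zero_le_power2[of "Re z"] zero_le_power2[of "Im z"] by linarith
  qed
  have "Im z = 0"
  proof (rule ccontr)
    assume "Im z \<noteq> 0"
    \<comment> \<open>This value of \<open>k\<close> makes \<open>k * Im z\<close> equal to |T|^2 +
      1.\<close>
    with bound[of "((norm T)\<^sup>2 + 1) / Im z"] have "2 * ((norm T)\<^sup>2 + 1) \<le> (norm T)\<^sup>2" by simp
    moreover have "N < 2 * (N + 1)" if "0 \<le> N" for N :: real using that by simp
    ultimately show False by (meson not_le zero_le_power2)
  qed
  then show ?thesis by (simp add: complex_is_Real_iff)
qed


section \<open>The equivalences\<close>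

text \<open>A normal functional that measures e - 1 vanishes on \<open>A\<close>, hence by density
  at the identity, which forces e = 1.\<close>

lemma invertible_in_dense_imp:
  assumes M: "von_neumann_algebra M" and d: "weak_star_dense A M" and x: "invertible_in A x"
  shows "invertible_in M x"
proof -
  obtain e y where e: "e \<in> A" "\<forall>a\<in>A. e o\<^sub>L a = a \<and> a o\<^sub>L e = a"
    and y: "y \<in> A" "x o\<^sub>L y = e" "y o\<^sub>L x = e" and xA: "x \<in> A"
    using x unfolding invertible_in_def by auto
  have AM: "A \<subseteq> M" using d by (simp add: weak_star_dense_def)
  have eB: "e \<in> bounded_ops" using vn_bounded_ops[OF M] AM e by blast
  have "e = id_blinfun"
  proof (rule blinfun_eqI)
    fix v
    let ?w = "e v - v"
    \<comment> \<open>This is <(e - 1)Tv, w> with e - 1 moved to the other side, which shows that it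
      lies in the predual.\<close>
    define f where "f = (\<lambda>T. cinner (blinfun_apply T v) (adj_op e ?w - ?w))"
    have f: "f T = cinner (e (T v) - T v) ?w" for T
    proof -
      have "f T = cinner (T v) (adj_op e ?w) - cinner (T v) ?w"
        using cinner_add_right[of "T v" "adj_op e ?w - ?w" ?w] by (simp add: f_def)
      then show ?thesis using eB by (simp add: cinner_diff_left adj_op_works)
    qed
    have fA: "f a = 0" if "a \<in> A" for a
    proof -
      have "e (a v) = a v" using e that by (metis blinfun_apply_blinfun_compose)
      then show ?thesis by (simp add: f)
    qed
    have fp: "f \<in> predual M" unfolding f_def by (rule cinner_in_predual)
    \<comment> \<open>If \<open>f\<close> did not vanish at the identity, this set would be a
      neighbourhood of the identity disjoint from \<open>A\<close>.\<close>
    have op: "openin (weak_star_topology M) {T \<in> M. f T \<in> - {0}}"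
      unfolding weak_star_topology_def
      by (rule topology_generated_by_Basis) (use fp in blast)
    have "id_blinfun \<in> weak_star_topology M closure_of A"
      using d vn_id[OF M] by (simp add: weak_star_dense_def)
    then have meets: "\<exists>a. a \<in> A \<and> a \<in> U"
      if "id_blinfun \<in> U" "openin (weak_star_topology M) U" for U
      using that unfolding in_closure_of by blast
    have "f id_blinfun = 0"
    proof (rule ccontr)
      assume "f id_blinfun \<noteq> 0"
      then obtain a where "a \<in> A" "f a \<noteq> 0"
        using meets[OF _ op] vn_id[OF M] by auto
      then show False using fA by simp
    qed
    \<comment> \<open>At the identity, \<open>f\<close> takes the value |ev - v|^2.\<close>
    then show "e v = id_blinfun v" by (simp add: f cinner_self_norm)
  qed
  then show ?thesis using y xA AM by (auto simp: invertible_in_vn_iff[OF M])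
qed

text \<open>A left inverse bounds \<open>x\<close> from below, because |v| = |yxv| \<le> |y| |xv|,
  and the quadratic form of \<open>adj_op x o\<^sub>L x\<close> at \<open>v\<close> is
  |xv|^2.\<close>

lemma coercive_of_left_inverse:
  assumes x: "x \<in> bounded_ops" and y: "y o\<^sub>L x = id_blinfun"
  obtains \<delta> where "\<delta> > 0" "\<And>v. \<delta> * (norm v)\<^sup>2 \<le> inner ((adj_op x o\<^sub>L x) v) v"
proof
  define K where "K = 1 + norm y"
  have K: "K > 0" by (simp add: K_def add_pos_nonneg)
  show "1 / K\<^sup>2 > 0" using K by simp
  fix v
  have "norm v = norm (y (x v))" using y by (metis blinfun_apply_blinfun_compose id_blinfun.rep_eq)
  also have "\<dots> \<le> norm y * norm (x v)" by (rule norm_blinfun)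
  also have "\<dots> \<le> K * norm (x v)" by (simp add: K_def mult_right_mono)
  finally have "(norm v)\<^sup>2 \<le> (K * norm (x v))\<^sup>2" by (rule power_mono) simp
  then have "1 / K\<^sup>2 * (norm v)\<^sup>2 \<le> (norm (x v))\<^sup>2"
    using K by (simp add: power_mult_distrib field_simps)
  also have "\<dots> = inner ((adj_op x o\<^sub>L x) v) v"
    by (simp add: inner_eq_Re_cinner cinner_adj_left[OF x] cinner_self_norm)
  finally show "1 / K\<^sup>2 * (norm v)\<^sup>2 \<le> inner ((adj_op x o\<^sub>L x) v) v" .
qed

text \<open>The inverse in \<open>M\<close> is recovered as \<open>S o\<^sub>L adj_op x\<close>,
  where \<open>S\<close> inverts the coercive element \<open>adj_op x o\<^sub>L x\<close> inside
  \<open>A\<close>.\<close>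

lemma invertible_in_cstar_subalgebra:
  assumes M: "von_neumann_algebra M" and A: "cstar_subalgebra A M" and xA: "x \<in> A"
    and x: "invertible_in M x"
  shows "invertible_in A x"
proof -
  obtain y where y: "y \<in> M" "x o\<^sub>L y = id_blinfun" "y o\<^sub>L x = id_blinfun"
    using x by (auto simp: invertible_in_vn_iff[OF M])
  have xB: "x \<in> bounded_ops" using vn_bounded_ops[OF M] A xA by (auto simp: cstar_subalgebra_def)
  obtain \<delta> where \<delta>: "\<delta> > 0" "\<And>v. \<delta> * (norm v)\<^sup>2 \<le> inner ((adj_op x o\<^sub>L x) v) v"
    using coercive_of_left_inverse[OF xB y(3)] by blast
  have "adj_op x o\<^sub>L x \<in> A" using xA by (intro cstar_comp[OF A] cstar_adj[OF A])
  then obtain S where S: "id_blinfun \<in> A" "S \<in> A" "S o\<^sub>L (adj_op x o\<^sub>L x) = id_blinfun"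
    using cstar_coercive_inverse[OF A _ \<delta>] by blast
  have "S o\<^sub>L adj_op x = (S o\<^sub>L (adj_op x o\<^sub>L x)) o\<^sub>L y"
    by (simp add: blinfun_compose_assoc y)
  also have "\<dots> = y" by (simp add: S)
  finally have "y \<in> A" using cstar_comp[OF A S(2) cstar_adj[OF A xA]] by simp
  then show ?thesis
    unfolding invertible_in_def using xA S(1) y
    by (intro conjI bexI[of _ id_blinfun] bexI[of _ y]) auto
qed

lemma normal_face_pos_imp_invertible:
  assumes M: "von_neumann_algebra M" and xM: "x \<in> M" and u: "u \<in> M" "unitary_op u"
    and eps: "\<epsilon> > 0" "\<And>f. f \<in> normal_face M u \<Longrightarrow> \<epsilon> \<le> Re (f x)"
  shows "invertible_in M x"
proof -
  note MM = vn_cstar[OF M]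
  have uB: "u \<in> bounded_ops" and uu: "adj_op u o\<^sub>L u = id_blinfun" "u o\<^sub>L adj_op u = id_blinfun"
    using u(2) by (simp_all add: unitary_op_def)
  note nu = unitary_op_norm[OF u(2)]
  have "norm u \<le> 1" by (rule norm_blinfun_bound) (simp_all add: nu)
  let ?a = "adj_op u o\<^sub>L x"
  have unit: "\<epsilon> \<le> inner (?a v) v" if v: "norm v = 1" for v
  proof -
    let ?f = "\<lambda>T. cinner (blinfun_apply T v) (u v)"
    have fu: "?f u = 1" by (simp add: cinner_self_norm nu v)
    have le: "cmod (?f T) \<le> 1" if "norm T \<le> 1" for T
    proof -
      have "cmod (?f T) \<le> norm (T v) * norm (u v)" by (rule norm_cinner_le)
      also have "\<dots> \<le> norm T" using norm_blinfun[of T v] by (simp add: nu v)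
      finally show ?thesis using that by simp
    qed
    \<comment> \<open>The supremum is attained at \<open>u\<close>, which lies in the unit ball of
      \<open>M\<close>.\<close>
    have "functional_norm M ?f = 1"
      unfolding functional_norm_def
    proof (rule cSup_eq_maximum)
      show "1 \<in> (\<lambda>T. cmod (?f T)) ` {T \<in> M. norm T \<le> 1}"
        using \<open>norm u \<le> 1\<close> u(1) fu by (intro image_eqI[of _ _ u]) auto
    qed (use le in auto)
    then have "?f \<in> normal_face M u"
      using cinner_in_predual[of v "u v" M] fu by (simp add: normal_face_def)
    from eps(2)[OF this] show ?thesis
      using cinner_adj_left[OF uB] by (simp add: inner_eq_Re_cinner)
  qed
  have coercive: "\<epsilon> * (norm v)\<^sup>2 \<le> inner (?a v) v" for v
  proof (cases "v = 0")
    case False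
    then have "\<epsilon> \<le> inner (?a ((1 / norm v) *\<^sub>R v)) ((1 / norm v) *\<^sub>R v)" by (intro unit) simp
    then show ?thesis using False by (simp add: blinfun.scaleR_right field_simps power2_eq_square)
  qed simp
  have aM: "?a \<in> M" by (intro cstar_comp[OF MM] cstar_adj[OF MM] u xM)
  obtain S where S: "S \<in> M" "?a o\<^sub>L S = id_blinfun" "S o\<^sub>L ?a = id_blinfun"
    using cstar_coercive_inverse[OF MM aM eps(1) coercive] .
  \<comment> \<open>Since x = u \<open>?a\<close>, the inverse of \<open>x\<close> is
    \<open>S\<close> followed on the right by \<open>adj_op u\<close>.\<close>
  have "x o\<^sub>L (S o\<^sub>L adj_op u) = (u o\<^sub>L adj_op u) o\<^sub>L x o\<^sub>L (S o\<^sub>L adj_op u)" by (simp add: uu)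
  also have "\<dots> = u o\<^sub>L (?a o\<^sub>L S) o\<^sub>L adj_op u" by (simp only: blinfun_compose_assoc)
  also have "\<dots> = id_blinfun" by (simp add: S uu)
  finally have "x o\<^sub>L (S o\<^sub>L adj_op u) = id_blinfun" .
  moreover have "(S o\<^sub>L adj_op u) o\<^sub>L x = id_blinfun" using S(3) by (simp add: blinfun_compose_assoc)
  ultimately show ?thesis
    unfolding invertible_in_vn_iff[OF M]
    using xM cstar_comp[OF MM S(1) cstar_adj[OF MM u(1)]] by blast
qed

text \<open>Scaling brings \<open>adj_op x o\<^sub>L x\<close> close to 1, where the square root
  \<open>s\<close> and its inverse exist. Positivity of \<open>s\<close> is recorded as closeness to
  1, the form that later bounds functionals from below.\<close>

lemma invertible_polar_decomposition:
  assumes M: "von_neumann_algebra M" and x: "invertible_in M x"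
  obtains u s t where "u \<in> M" "unitary_op u" "s \<in> M" "symmetric_op s" "norm (id_blinfun - s) < 1"
    "t > 0" "x = u o\<^sub>L (t *\<^sub>R s)"
proof -
  note MM = vn_cstar[OF M]
  obtain y where xM: "x \<in> M" and y: "y \<in> M" "x o\<^sub>L y = id_blinfun" "y o\<^sub>L x = id_blinfun"
    using x by (auto simp: invertible_in_vn_iff[OF M])
  have xB: "x \<in> bounded_ops" using vn_bounded_ops[OF M] xM by blast
  let ?a = "adj_op x o\<^sub>L x"
  obtain \<delta> where \<delta>: "\<delta> > 0" "\<And>v. \<delta> * (norm v)\<^sup>2 \<le> inner (?a v) v"
    using coercive_of_left_inverse[OF xB y(3)] by blast
  obtain t where t: "t > 0" "norm (id_blinfun - t *\<^sub>R ?a) < 1"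
    using coercive_contraction[OF \<delta>] .
  have aM: "t *\<^sub>R ?a \<in> M"
    using xM by (intro cstar_scaleR[OF MM] cstar_comp[OF MM] cstar_adj[OF MM])
  have "inner (?a v) w = inner v (?a w)" for v w
    by (simp add: inner_eq_Re_cinner cinner_adj_left[OF xB] flip: adj_op_works[OF xB])
  then have "symmetric_op (t *\<^sub>R ?a)" by (simp add: symmetric_op_def blinfun.scaleR_left)
  then obtain s where s: "s \<in> M" "symmetric_op s" "norm (id_blinfun - s) < 1" "s o\<^sub>L s = t *\<^sub>R ?a"
    using cstar_sqrt[OF MM vn_id[OF M] vn_bounded_ops[OF M] aM _ t(2)] by blast
  obtain z where z: "z \<in> M" "s o\<^sub>L z = id_blinfun" "z o\<^sub>L s = id_blinfun"
    using cstar_inverse[OF MM s(1) s(3)] .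
  \<comment> \<open>From s^2 = t \<open>?a\<close> and z = s^{-1} it follows that \<open>u\<close>
    preserves inner products.\<close>
  define u where "u = sqrt t *\<^sub>R (x o\<^sub>L z)"
  have uM: "u \<in> M" using xM z by (simp add: u_def cstar_scaleR[OF MM] cstar_comp[OF MM])
  have uB: "u \<in> bounded_ops" and sB: "s \<in> bounded_ops"
    using vn_bounded_ops[OF M] uM s(1) by auto
  have sz: "s (z v) = v" for v using z(2) by (metis blinfun_apply_blinfun_compose id_blinfun.rep_eq)
  have cu: "cinner (u v) (u w) = cinner v w" for v w
  proof -
    have "cinner (u v) (u w) = complex_of_real (sqrt t * sqrt t) * cinner (x (z v)) (x (z w))"
      by (simp add: u_def blinfun.scaleR_left scaleR_scaleC[of _ "_ :: 'a"] cinner_scaleC_left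
          cinner_scaleC_right del: real_sqrt_mult_self)
    also have "\<dots> = complex_of_real t * cinner (z v) (?a (z w))"
      using t(1) by (simp add: adj_op_works[OF xB])
    also have "\<dots> = cinner (z v) ((t *\<^sub>R ?a) (z w))"
      by (simp add: blinfun.scaleR_left scaleR_scaleC[of _ "_ :: 'a"] cinner_scaleC_right)
    also have "\<dots> = cinner (z v) (s (s (z w)))" by (simp flip: s(4))
    also have "\<dots> = cinner v w" by (simp add: sz flip: symmetric_op_cinner[OF sB s(2)])
    finally show ?thesis .
  qed
  have uu: "adj_op u o\<^sub>L u = id_blinfun"
    by (rule blinfun_eqI, rule cinner_extensional) (simp add: cu flip: adj_op_works[OF uB])
  \<comment> \<open>An isometry need not be surjective; this right inverse, built from
    \<open>y\<close>, must coincide with the left inverse \<open>adj_op u\<close>.\<close>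
  have uv: "u o\<^sub>L ((1 / sqrt t) *\<^sub>R (s o\<^sub>L y)) = id_blinfun"
  proof -
    have "u o\<^sub>L ((1 / sqrt t) *\<^sub>R (s o\<^sub>L y)) = x o\<^sub>L (z o\<^sub>L s) o\<^sub>L y"
      using t(1) by (simp add: u_def blinfun_compose_scaleR_left blinfun_compose_scaleR_right
          blinfun_compose_assoc)
    then show ?thesis by (simp add: z y)
  qed
  have "adj_op u = (adj_op u o\<^sub>L u) o\<^sub>L ((1 / sqrt t) *\<^sub>R (s o\<^sub>L y))"
    by (simp only: blinfun_compose_assoc uv) simp
  then have "adj_op u = (1 / sqrt t) *\<^sub>R (s o\<^sub>L y)" by (simp add: uu)
  then have "unitary_op u" using uB uu uv by (simp add: unitary_op_def)
  moreover have "x = u o\<^sub>L ((1 / sqrt t) *\<^sub>R s)"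
    using t(1) z(3) by (simp add: u_def blinfun_compose_scaleR_left blinfun_compose_scaleR_right
        blinfun_compose_assoc)
  \<comment> \<open>The scalar in the conclusion is the reciprocal square root of the local
    \<open>t\<close>.\<close>
  ultimately show thesis using that[of u s "1 / sqrt t"] uM s t(1) by simp
qed

text \<open>Translating \<open>f\<close> by \<open>u\<close> gives a functional that is contractive
  on \<open>M\<close> and has value 1 at the identity. Such a functional is real on symmetric
  elements and moves at most |1 - s| away from 1 at \<open>s\<close>.\<close>

lemma invertible_imp_normal_face_pos:
  assumes M: "von_neumann_algebra M" and x: "invertible_in M x"
  obtains u \<epsilon> where "u \<in> M" "unitary_op u" "\<epsilon> > 0"
    "\<And>f. f \<in> normal_face M u \<Longrightarrow> f x \<in> \<real> \<and> \<epsilon> \<le> Re (f x)"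
proof -
  note MM = vn_cstar[OF M]
  obtain u s t where u: "u \<in> M" "unitary_op u" and s: "s \<in> M" "symmetric_op s" "norm (id_blinfun - s) < 1"
    and t: "t > 0" and xu: "x = u o\<^sub>L (t *\<^sub>R s)"
    using invertible_polar_decomposition[OF M x] by blast
  have uB: "u \<in> bounded_ops" and sB: "s \<in> bounded_ops"
    using vn_bounded_ops[OF M] u s(1) by auto
  have nu: "norm u \<le> 1"
    by (intro norm_blinfun_bound) (simp_all add: unitary_op_norm[OF u(2)])
  let ?r = "norm (id_blinfun - s)"
  \<comment> \<open>The lower bound depends only on \<open>s\<close> and \<open>t\<close>, so one
    constant serves the whole face.\<close>
  have face: "f x \<in> \<real> \<and> t * (1 - ?r) \<le> Re (f x)" if f: "f \<in> normal_face M u" for f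
  proof -
    have fp: "f \<in> predual M" and fu: "f u = 1" and fn: "functional_norm M f = 1"
      using f by (auto simp: normal_face_def)
    define g where "g T = f (u o\<^sub>L T)" for T
    have gadd: "g (S + T) = g S + g T" if "S \<in> M" "T \<in> M" for S T
      using fp cstar_comp[OF MM u(1)] that by (simp add: g_def predual_def blinfun_compose_add_right)
    have gscale: "g (c *\<^sub>C T) = c * g T" if "T \<in> M" for c T
    proof -
      have "u o\<^sub>L (c *\<^sub>C T) = c *\<^sub>C (u o\<^sub>L T)"
        by (rule blinfun_eqI) (simp add: scaleC_blinfun.rep_eq bounded_opsD[OF uB])
      then show ?thesis using fp cstar_comp[OF MM u(1) that] by (simp add: g_def predual_def)
    qed
    have gid: "g id_blinfun = 1" by (simp add: g_def fu)
    have gle: "cmod (g T) \<le> norm T" if "T \<in> M" for T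
    proof -
      have "cmod (g T) \<le> norm (u o\<^sub>L T)"
        using predual_norm_le[OF MM fp cstar_comp[OF MM u(1) that]] by (simp add: g_def fn)
      also have "\<dots> \<le> norm u * norm T" by (rule norm_blinfun_compose)
      also have "\<dots> \<le> norm T" using nu by (simp add: mult_left_le_one_le)
      finally show ?thesis .
    qed
    note idM = vn_id[OF M]
    have "g s \<in> \<real>"
    proof (rule real_of_cmod_le_norm_symmetric_op[OF sB s(2)])
      fix k :: real
      have "g (s + (\<i> * complex_of_real k) *\<^sub>C id_blinfun) = g s + \<i> * complex_of_real k"
        using s(1) idM by (simp add: gadd gscale gid cstar_scaleC[OF MM])
      then show "cmod (g s + \<i> * complex_of_real k) \<le> norm (s + (\<i> * complex_of_real k) *\<^sub>C id_blinfun)"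
        using gle[of "s + (\<i> * complex_of_real k) *\<^sub>C id_blinfun"] s(1) idM
        by (simp add: cstar_add[OF MM] cstar_scaleC[OF MM])
    qed
    moreover have "1 - ?r \<le> Re (g s)"
    proof -
      have "g id_blinfun = g (id_blinfun - s) + g s"
        using gadd[of "id_blinfun - s" s] s(1) idM by (simp add: cstar_diff[OF MM])
      then have "1 - g s = g (id_blinfun - s)" by (simp add: gid algebra_simps)
      then have "cmod (1 - g s) \<le> ?r" using gle[of "id_blinfun - s"] s(1) idM by (simp add: cstar_diff[OF MM])
      then show ?thesis using complex_Re_le_cmod[of "1 - g s"] by simp
    qed
    moreover have "f x = complex_of_real t * g s"
      using gscale[OF s(1)] by (simp add: xu g_def scaleR_scaleC)
    ultimately show ?thesis using t by (simp add: Reals_mult mult_left_mono)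
  qed
  show thesis
    by (rule that[OF u, of "t * (1 - ?r)"]) (use t s(3) face in auto)
qed

theorem corollary5:
  fixes M A :: "('h :: chilbert_space \<Rightarrow>\<^sub>L 'h) set" and x :: "'h \<Rightarrow>\<^sub>L 'h"
  assumes "von_neumann_algebra M"
    and "cstar_subalgebra A M"
    and "weak_star_dense A M"
    and "x \<in> A"
  shows "(invertible_in A x \<longleftrightarrow> invertible_in M x) \<and>
    (invertible_in M x \<longleftrightarrow>
      (\<exists>u\<in>M. \<exists>\<epsilon>>0. unitary_op u \<and>
        (\<forall>f\<in>normal_face M u. f x \<in> \<real> \<and> \<epsilon> \<le> Re (f x))))"
proof (intro conjI iffI)
  show "invertible_in M x" if "invertible_in A x"
    using invertible_in_dense_imp[OF assms(1,3) that] .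
  show "invertible_in A x" if "invertible_in M x"
    using invertible_in_cstar_subalgebra[OF assms(1,2,4) that] .
  show "\<exists>u\<in>M. \<exists>\<epsilon>>0. unitary_op u \<and> (\<forall>f\<in>normal_face M u. f x \<in> \<real> \<and> \<epsilon> \<le> Re (f x))"
    if "invertible_in M x"
    using invertible_imp_normal_face_pos[OF assms(1) that] by metis
  have "x \<in> M" using assms(2,4) by (auto simp: cstar_subalgebra_def)
  then show "invertible_in M x"
    if "\<exists>u\<in>M. \<exists>\<epsilon>>0. unitary_op u \<and> (\<forall>f\<in>normal_face M u. f x \<in> \<real> \<and> \<epsilon> \<le> Re (f x))"
    using that normal_face_pos_imp_invertible[OF assms(1)] by blast
qed

end
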